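(* (Homotopy Lifting Property) Let $X$ be a graph with no 3-cycles or 4-cycles and let $(\widetilde{X},\rho)$ be a covering graph of $X$. Given a graph homotopy $H: Y\,\square\, I_n \to X$ from $f$ to $g$ (where $f,g:(Y,y_0)\to(X,x_0)$ are graph homomorphisms) and a lift $\widetilde{f}: Y \to \widetilde{X}$ of $f$, there exists a unique graph homotopy $\widetilde{H}: Y\,\square\, I_n \to \widetilde{X}$ that lifts $H$ (that is, $\rho\circ\widetilde H=H$) with $\widetilde{H}(y,0)=\widetilde{f}(y)$ for all $y\in V(Y)$. Here $\widetilde X$ carries the distinguished vertex $\widetilde f(y_0)$.
   Context: Graphs: every graph $X$ is a simple graph (possibly infinite) with a loop attached at every vertex, with vertex set $V(X)$ and edge set $E(X)$; $v,w$ are adjacent if $vw\in E(X)$, so every vertex is adjacent to itself. A graph homomorphism $f:X\to Y$ is a map $V(X)\to V(Y)$ with $f(u)f(v)\in E(Y)$ whenever $uv\in E(X)$. $(X,x_0)$ denotes a graph with distinguished vertex $x_0$, and a (based) graph homomorphism $f:(X,x_0)\to(Y,y_0)$ satisfies $f(x_0)=y_0$. "No 3-cycles or 4-cycles" means that $X$ contains no cycle on 3 or 4 distinct vertices as a (not necessarily induced) subgraph. Products and homotopies: $X\,\square\, Y$ is the graph with vertex set $V(X)\times V(Y)$ in which $(x_1,y_1)$ and $(x_2,y_2)$ are adjacent iff either $x_1=x_2$ and $y_1y_2\in E(Y)$, or $y_1=y_2$ and $x_1x_2\in E(X)$. $I_n$ is the path with vertices $0,1,\dots,n$ (with $i,j$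 adjacent iff $|i-j|\le1$). For graph homomorphisms $f,g:(Y,y_0)\to(X,x_0)$, a graph homotopy from $f$ to $g$ is a graph homomorphism $H:Y\,\square\, I_n\to X$, for some positive integer $n$, such that $H(v,0)=f(v)$ and $H(v,n)=g(v)$ for all $v\in V(Y)$ and $H(y_0,i)=x_0$ for all $0\le i\le n$. Thus $\widetilde H$ being a graph homotopy means it is a graph homotopy from $\widetilde H(\cdot,0)$ to $\widetilde H(\cdot,n)$ fixing the distinguished vertex. Coverings: for $x\in V(X)$ let $N[x]=\{v\in V(X) : vx\in E(X)\}$. A graph homomorphism $\rho:X\to Y$ is a local isomorphism if for each $y\in V(Y)$ and each $x\in\rho^{-1}(y)$ the restriction $\rho|_{N[x]}:N[x]\to N[y]$ is bijective. A pair $(\widetilde{X},\rho)$ with $\rho:\widetilde{X}\to X$ a graph homomorphism is a covering graph of $X$ if $\rho$ is a surjective local isomorphism. A lift of a graph homomorphism $f:Y\to X$ is a graph homomorphism $\widetilde f:Y\to\widetilde X$ with $\rho\circ\widetilde f=f$. *)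

theory Defs
  imports Main "HOL-Library.FuncSet"
begin

text \<open>Edges are stored as a reflexive symmetric relation on the vertex set, so an undirected edge
  \<open>uv\<close> is represented by both ordered pairs, and every vertex carries a loop.\<close>

record 'a rgraph =
  verts :: "'a set"
  edges :: "'a rel"

definition graph :: "'a rgraph \<Rightarrow> bool" where
  "graph X \<longleftrightarrow> edges X \<subseteq> verts X \<times> verts X \<and> refl_on (verts X) (edges X) \<and> sym (edges X)"

definition pointed_graph :: "'a rgraph \<Rightarrow> 'a \<Rightarrow> bool" where
  "pointed_graph X x \<longleftrightarrow> graph X \<and> x \<in> verts X"

text \<open>Vertex maps are only meaningful on \<open>verts X\<close>; their values elsewhere are unconstrained,
  so uniqueness of such a map has to be stated among the maps \<^const>\<open>extensional\<close> on \<open>verts X\<close>.\<close>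

definition graph_hom :: "'a rgraph \<Rightarrow> 'b rgraph \<Rightarrow> ('a \<Rightarrow> 'b) \<Rightarrow> bool" where
  "graph_hom X Y f \<longleftrightarrow>
     f \<in> verts X \<rightarrow> verts Y \<and> (\<forall>u v. (u, v) \<in> edges X \<longrightarrow> (f u, f v) \<in> edges Y)"

definition based_hom :: "'a rgraph \<Rightarrow> 'a \<Rightarrow> 'b rgraph \<Rightarrow> 'b \<Rightarrow> ('a \<Rightarrow> 'b) \<Rightarrow> bool" where
  "based_hom X x Y y f \<longleftrightarrow> graph_hom X Y f \<and> f x = y"

definition is_cycle :: "'a rgraph \<Rightarrow> 'a list \<Rightarrow> bool" where
  "is_cycle X vs \<longleftrightarrow> 3 \<le> length vs \<and> distinct vs \<and> set vs \<subseteq> verts X \<and>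
     (\<forall>i < length vs. (vs ! i, vs ! (Suc i mod length vs)) \<in> edges X)"

definition has_cycle_of_length :: "'a rgraph \<Rightarrow> nat \<Rightarrow> bool" where
  "has_cycle_of_length X k \<longleftrightarrow> (\<exists>vs. is_cycle X vs \<and> length vs = k)"

definition box_prod :: "'a rgraph \<Rightarrow> 'b rgraph \<Rightarrow> ('a \<times> 'b) rgraph" (infixr "\<square>" 70) where
  "X \<square> Y = \<lparr>verts = verts X \<times> verts Y,
     edges = {((x1, y1), (x2, y2)).
       (x1 = x2 \<and> x1 \<in> verts X \<and> (y1, y2) \<in> edges Y) \<or>
       (y1 = y2 \<and> y1 \<in> verts Y \<and> (x1, x2) \<in> edges X)}\<rparr>"

definition path_graph :: "nat \<Rightarrow> nat rgraph" where
  "path_graph n = \<lparr>verts = {0..n},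
     edges = {(i, j). i \<le> n \<and> j \<le> n \<and> \<bar>int i - int j\<bar> \<le> 1}\<rparr>"

definition graph_homotopy ::
  "'a rgraph \<Rightarrow> 'a \<Rightarrow> 'b rgraph \<Rightarrow> 'b \<Rightarrow> nat \<Rightarrow> ('a \<Rightarrow> 'b) \<Rightarrow> ('a \<Rightarrow> 'b) \<Rightarrow> ('a \<times> nat \<Rightarrow> 'b) \<Rightarrow> bool" where
  "graph_homotopy Y y0 X x0 n f g H \<longleftrightarrow>
     based_hom Y y0 X x0 f \<and> based_hom Y y0 X x0 g \<and>
     0 < n \<and> graph_hom (Y \<square> path_graph n) X H \<and>
     (\<forall>v \<in> verts Y. H (v, 0) = f v \<and> H (v, n) = g v) \<and>
     (\<forall>i \<le> n. H (y0, i) = x0)"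

definition closed_nbhd :: "'a rgraph \<Rightarrow> 'a \<Rightarrow> 'a set" where
  "closed_nbhd X x = {v \<in> verts X. (v, x) \<in> edges X}"

definition local_isomorphism :: "'a rgraph \<Rightarrow> 'b rgraph \<Rightarrow> ('a \<Rightarrow> 'b) \<Rightarrow> bool" where
  "local_isomorphism X Y \<rho> \<longleftrightarrow> graph_hom X Y \<rho> \<and>
     (\<forall>y \<in> verts Y. \<forall>x \<in> verts X. \<rho> x = y \<longrightarrow> bij_betw \<rho> (closed_nbhd X x) (closed_nbhd Y y))"

definition covering_graph :: "'a rgraph \<Rightarrow> ('a \<Rightarrow> 'b) \<Rightarrow> 'b rgraph \<Rightarrow> bool" where
  "covering_graph X' \<rho> X \<longleftrightarrow>
     graph X' \<and> local_isomorphism X' X \<rho> \<and> \<rho> ` verts X' = verts X"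

definition is_lift ::
  "'a rgraph \<Rightarrow> 'c rgraph \<Rightarrow> ('c \<Rightarrow> 'b) \<Rightarrow> ('a \<Rightarrow> 'b) \<Rightarrow> ('a \<Rightarrow> 'c) \<Rightarrow> bool" where
  "is_lift Y X' \<rho> f f' \<longleftrightarrow> graph_hom Y X' f' \<and> (\<forall>v \<in> verts Y. \<rho> (f' v) = f v)"

lemma graph_box_prod: "graph X \<Longrightarrow> graph Y \<Longrightarrow> graph (X \<square> Y)"
  by (auto simp: graph_def box_prod_def refl_on_def sym_def)

lemma graph_path_graph: "graph (path_graph n)"
  by (auto simp: graph_def path_graph_def refl_on_def sym_def)

end

theory Submission
  imports Defs
begin

text \<open>A covering map is bijective on closed neighbourhoods, so a track \<open>H (y, 0), H (y, 1), \<dots>\<close>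
  of the homotopy lifts in exactly one way once its first vertex is lifted: at every time the next
  vertex is the only neighbour of the current one in the correct fibre. This gives uniqueness and
  forces the definition of \<open>H'\<close>. The lifted base track is constant because, thanks to the loops, a
  vertex is its own only neighbour in its fibre.

  What remains is that \<open>H'\<close> preserves the edges of \<open>Y\<close> at every time. By induction on time this
  is a statement about one square: the images of an edge of \<open>Y\<close> at two consecutive times form a
  closed walk \<open>a, b, c, d\<close> of length 4 in \<open>X\<close>, three of whose sides have been lifted. In the absence
  of 3-cycles and 4-cycles such a walk can only stall or backtrack (lemma \<open>closed_4_walk_degenerate\<close>),
  and then the lifted sides retrace one another in the same way, so that the fourth side is an edge
  as well (lemma \<open>covering_completes_square\<close>).\<close>

section \<open>Homomorphisms on graphs with loops\<close>

lemma graph_edge_verts: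
  assumes "graph X" and "(u, v) \<in> edges X"
  shows "u \<in> verts X" and "v \<in> verts X"
  using assms by (auto simp: graph_def)

lemma graph_edge_sym: "graph X \<Longrightarrow> (u, v) \<in> edges X \<Longrightarrow> (v, u) \<in> edges X"
  by (auto simp: graph_def sym_def)

lemma graph_loop: "graph X \<Longrightarrow> v \<in> verts X \<Longrightarrow> (v, v) \<in> edges X"
  by (auto simp: graph_def refl_on_def)

text \<open>The loops reduce a graph homomorphism on the cylinder to its horizontal and vertical edges:
  preservation of vertices follows from preservation of loops.\<close>

lemma graph_hom_cylinder_iff:
  assumes "graph X" and "graph Y"
  shows "graph_hom (Y \<square> path_graph n) X H \<longleftrightarrow>
    (\<forall>i \<le> n. \<forall>u v. (u, v) \<in> edges Y \<longrightarrow> (H (u, i), H (v, i)) \<in> edges X) \<and>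
    (\<forall>i < n. \<forall>y \<in> verts Y. (H (y, i), H (y, Suc i)) \<in> edges X)"
    (is "?hom \<longleftrightarrow> ?horizontal \<and> ?vertical")
proof
  assume ?hom
  then have "\<And>p q. (p, q) \<in> edges (Y \<square> path_graph n) \<Longrightarrow> (H p, H q) \<in> edges X"
    unfolding graph_hom_def by blast
  then show "?horizontal \<and> ?vertical"
    by (auto simp: box_prod_def path_graph_def)
next
  assume hv: "?horizontal \<and> ?vertical"
  have "H p \<in> verts X" if "p \<in> verts (Y \<square> path_graph n)" for p
  proof -
    obtain y i where p: "p = (y, i)" "y \<in> verts Y" "i \<le> n"
      using \<open>p \<in> verts (Y \<square> path_graph n)\<close> by (auto simp: box_prod_def path_graph_def)
    then have "(H (y, i), H (y, i)) \<in> edges X"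
      using hv graph_loop[OF assms(2)] by blast
    then show ?thesis
      using p graph_edge_verts[OF assms(1)] by blast
  qed
  moreover have "(H p, H q) \<in> edges X" if edge: "(p, q) \<in> edges (Y \<square> path_graph n)" for p q
  proof -
    obtain u i v j where pq: "p = (u, i)" "q = (v, j)" by (cases p, cases q)
    consider "i = j" "i \<le> n" "(u, v) \<in> edges Y"
      | "u = v" "u \<in> verts Y" "i \<le> n" "j \<le> n" "\<bar>int i - int j\<bar> \<le> 1"
      using edge pq by (auto simp: box_prod_def path_graph_def)
    then show ?thesis
    proof cases
      case 1
      then show ?thesis using hv pq by blast
    next
      case 2
      then consider "i = j" | "j = Suc i" "i < n" | "i = Suc j" "j < n" by linarith
      then show ?thesis
      proof cases
        case 1
        then show ?thesis
          using 2 pq hv graph_loop[OF assms(2), of u] by simp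
      next
        case 2
        then show ?thesis
          using \<open>u = v\<close> \<open>u \<in> verts Y\<close> pq hv by simp
      next
        case 3
        then have "(H q, H p) \<in> edges X"
          using \<open>u = v\<close> \<open>u \<in> verts Y\<close> pq hv by simp
        then show ?thesis
          by (rule graph_edge_sym[OF assms(1)])
      qed
    qed
  qed
  ultimately show ?hom
    by (auto simp: graph_hom_def)
qed

section \<open>Closed walks of length 4\<close>

lemma no_triangle:
  assumes "graph X" and "\<not> has_cycle_of_length X 3"
    and "(a, b) \<in> edges X" and "(b, c) \<in> edges X" and "(c, a) \<in> edges X"
  shows "a = b \<or> b = c \<or> a = c"
proof (rule ccontr)
  assume "\<not> ?thesis"
  moreover have "set [a, b, c] \<subseteq> verts X"
    using assms(3-5)[THEN graph_edge_verts(1)[OF assms(1)]] by simp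
  ultimately have "is_cycle X [a, b, c]"
    using assms(3-5) by (simp add: is_cycle_def All_less_Suc)
  then have "has_cycle_of_length X 3"
    unfolding has_cycle_of_length_def by (intro exI[of _ "[a, b, c]"]) simp
  then show False
    using assms(2) by simp
qed

text \<open>A walk without repeated vertices would be a 4-cycle. If opposite vertices coincide there is
  nothing to show; if consecutive ones do, deleting one of them leaves a closed walk of length 3, in
  which a second coincidence is forced by the absence of triangles.\<close>

lemma closed_4_walk_degenerate:
  assumes "graph X" and "\<not> has_cycle_of_length X 3" and "\<not> has_cycle_of_length X 4"
    and "(a, b) \<in> edges X" and "(b, c) \<in> edges X" and "(c, d) \<in> edges X" and "(d, a) \<in> edges X"
  shows "a = c \<or> b = d \<or> (a = b \<and> c = d) \<or> (a = d \<and> b = c)"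
proof (cases "distinct [a, b, c, d]")
  case True
  moreover have "set [a, b, c, d] \<subseteq> verts X"
    using assms(4-7)[THEN graph_edge_verts(1)[OF assms(1)]] by simp
  ultimately have "is_cycle X [a, b, c, d]"
    using assms(4-7) by (simp add: is_cycle_def All_less_Suc)
  then have "has_cycle_of_length X 4"
    unfolding has_cycle_of_length_def by (intro exI[of _ "[a, b, c, d]"]) simp
  then show ?thesis
    using assms(3) by simp
next
  case False
  then consider "a = c" | "b = d" | "a = b" | "b = c" | "c = d" | "d = a" by auto
  then show ?thesis
    using no_triangle[OF assms(1,2), of a b c] no_triangle[OF assms(1,2), of b c d]
      no_triangle[OF assms(1,2), of c d a] no_triangle[OF assms(1,2), of d a b] assms(4-7)
    by cases auto
qed

section \<open>Lifting edges and squares\<close>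

lemma covering_unique_lift_of_edge:
  assumes "graph X" and "covering_graph X' \<rho> X"
    and "x \<in> verts X'" and "(\<rho> x, w) \<in> edges X"
  shows "\<exists>!v. (x, v) \<in> edges X' \<and> \<rho> v = w"
proof -
  have X': "graph X'" and bij: "bij_betw \<rho> (closed_nbhd X' x) (closed_nbhd X (\<rho> x))"
    using assms graph_edge_verts[OF assms(1)]
    by (auto simp: covering_graph_def local_isomorphism_def)
  have nbhd: "v \<in> closed_nbhd X' x \<longleftrightarrow> (x, v) \<in> edges X'" for v
    using graph_edge_verts[OF X'] graph_edge_sym[OF X'] by (auto simp: closed_nbhd_def)
  have "w \<in> closed_nbhd X (\<rho> x)"
    using graph_edge_verts(2)[OF assms(1,4)] graph_edge_sym[OF assms(1,4)]
    by (simp add: closed_nbhd_def)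
  then have "w \<in> \<rho> ` closed_nbhd X' x"
    using bij by (simp add: bij_betw_imp_surj_on)
  then have "\<exists>!v. v \<in> closed_nbhd X' x \<and> \<rho> v = w"
    using bij_betw_imp_inj_on[OF bij] by (auto dest: inj_onD)
  then show ?thesis
    by (simp add: nbhd)
qed

lemma covering_edge:
  assumes "covering_graph X' \<rho> X" and "(u, v) \<in> edges X'"
  shows "(\<rho> u, \<rho> v) \<in> edges X"
  using assms by (auto simp: covering_graph_def local_isomorphism_def graph_hom_def)

lemma covering_inj_on_neighbours:
  assumes "graph X" and "covering_graph X' \<rho> X"
    and "(x, u) \<in> edges X'" and "(x, v) \<in> edges X'" and "\<rho> u = \<rho> v"
  shows "u = v"
proof -
  have "x \<in> verts X'"
    using assms(2,3) graph_edge_verts by (auto simp: covering_graph_def)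
  then show ?thesis
    using covering_unique_lift_of_edge[OF assms(1,2) _ covering_edge[OF assms(2,4)]] assms
    by metis
qed

text \<open>In each degenerate form of the image of the walk \<open>a, b, c, d\<close>, injectivity of \<open>\<rho>\<close> on a neighbourhood turns a
  coincidence of vertices below into one above, and \<open>(d, c)\<close> becomes one of the given edges,
  reversed or not, or a loop.\<close>

lemma covering_completes_square:
  assumes "graph X" and "\<not> has_cycle_of_length X 3" and "\<not> has_cycle_of_length X 4"
    and cov: "covering_graph X' \<rho> X"
    and ab: "(a, b) \<in> edges X'" and ad: "(a, d) \<in> edges X'" and bc: "(b, c) \<in> edges X'"
    and image: "(\<rho> d, \<rho> c) \<in> edges X"
  shows "(d, c) \<in> edges X'"
proof -
  have X': "graph X'"
    using cov by (simp add: covering_graph_def)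
  note inj = covering_inj_on_neighbours[OF assms(1) cov]
  note sym = graph_edge_sym[OF X']
  have loop: "(v, v) \<in> edges X'" if "(u, v) \<in> edges X'" for u v
    using that graph_edge_verts[OF X'] graph_loop[OF X'] by blast
  consider "\<rho> a = \<rho> c" | "\<rho> b = \<rho> d" | "\<rho> a = \<rho> b" "\<rho> c = \<rho> d" | "\<rho> a = \<rho> d" "\<rho> b = \<rho> c"
    using closed_4_walk_degenerate[OF assms(1-3) covering_edge[OF cov ab] covering_edge[OF cov bc]
        graph_edge_sym[OF assms(1) image] graph_edge_sym[OF assms(1) covering_edge[OF cov ad]]]
    by auto
  then show ?thesis
  proof cases
    case 1
    then have "a = c" using inj[OF sym[OF ab] bc] by simp
    then show ?thesis using sym[OF ad] by simp
  next
    case 2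
    then have "b = d" using inj[OF ab ad] by simp
    then show ?thesis using bc by simp
  next
    case 3
    then have "a = b" using inj[OF loop[OF sym[OF ab]] ab] by simp
    then have "c = d" using inj[OF ad, of c] bc 3 by simp
    then show ?thesis using loop[OF bc] by simp
  next
    case 4
    then have "a = d" "b = c"
      using inj[OF loop[OF sym[OF ab]] ad] inj[OF loop[OF ab] bc] by simp_all
    then show ?thesis using ab by simp
  qed
qed

section \<open>Lifting walks and homotopies\<close>

primrec lift_track :: "'c rgraph \<Rightarrow> ('c \<Rightarrow> 'a) \<Rightarrow> (nat \<Rightarrow> 'a) \<Rightarrow> 'c \<Rightarrow> nat \<Rightarrow> 'c" where
  "lift_track X' \<rho> h x 0 = x"
| "lift_track X' \<rho> h x (Suc i) =
     (THE v. (lift_track X' \<rho> h x i, v) \<in> edges X' \<and> \<rho> v = h (Suc i))"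

lemma lift_track_step:
  assumes "graph X" and cov: "covering_graph X' \<rho> X"
    and "x \<in> verts X'" and "\<rho> x = h 0"
    and walk: "\<And>i. i < n \<Longrightarrow> (h i, h (Suc i)) \<in> edges X"
  shows "i \<le> n \<Longrightarrow> lift_track X' \<rho> h x i \<in> verts X' \<and> \<rho> (lift_track X' \<rho> h x i) = h i"
    and "i < n \<Longrightarrow> (lift_track X' \<rho> h x i, lift_track X' \<rho> h x (Suc i)) \<in> edges X'"
proof -
  let ?l = "lift_track X' \<rho> h x"
  have X': "graph X'"
    using cov by (simp add: covering_graph_def)
  have step: "(?l i, ?l (Suc i)) \<in> edges X' \<and> \<rho> (?l (Suc i)) = h (Suc i)"
    if "i < n" "?l i \<in> verts X' \<and> \<rho> (?l i) = h i" for i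
    using theI'[OF covering_unique_lift_of_edge[OF assms(1) cov, of "?l i" "h (Suc i)"]]
      that walk[of i] by simp
  have over: "i \<le> n \<Longrightarrow> ?l i \<in> verts X' \<and> \<rho> (?l i) = h i" for i
  proof (induction i)
    case 0
    then show ?case using assms(3,4) by simp
  next
    case (Suc i)
    then show ?case using step[of i] graph_edge_verts[OF X'] by auto
  qed
  show "i \<le> n \<Longrightarrow> ?l i \<in> verts X' \<and> \<rho> (?l i) = h i"
    by (rule over)
  show "i < n \<Longrightarrow> (?l i, ?l (Suc i)) \<in> edges X'"
    using step over by simp
qed

lemma walk_lift_unique:
  assumes "graph X" and "covering_graph X' \<rho> X"
    and k: "\<And>i. i < n \<Longrightarrow> (k i, k (Suc i)) \<in> edges X'"
    and l: "\<And>i. i < n \<Longrightarrow> (l i, l (Suc i)) \<in> edges X'"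
    and "k 0 = l 0" and same: "\<And>i. i \<le> n \<Longrightarrow> \<rho> (k i) = \<rho> (l i)"
  shows "i \<le> n \<Longrightarrow> k i = l i"
proof (induction i)
  case 0
  show ?case by (rule \<open>k 0 = l 0\<close>)
next
  case (Suc i)
  then show ?case
    using covering_inj_on_neighbours[OF assms(1,2) k[of i], of "l (Suc i)"] l[of i]
      same[of "Suc i"] by simp
qed

theorem theorem3p0p10:
  fixes X :: "'a rgraph" and X' :: "'c rgraph" and Y :: "'b rgraph"
    and \<rho> :: "'c \<Rightarrow> 'a" and f g :: "'b \<Rightarrow> 'a" and f' :: "'b \<Rightarrow> 'c"
    and H :: "'b \<times> nat \<Rightarrow> 'a" and x0 :: 'a and y0 :: 'b and n :: nat
  assumes "pointed_graph X x0" and "pointed_graph Y y0"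
    and "\<not> has_cycle_of_length X 3" and "\<not> has_cycle_of_length X 4"
    and "covering_graph X' \<rho> X"
    and "graph_homotopy Y y0 X x0 n f g H"
    and "is_lift Y X' \<rho> f f'"
  shows "\<exists>!H'. H' \<in> extensional (verts (Y \<square> path_graph n)) \<and>
    graph_homotopy Y y0 X' (f' y0) n (\<lambda>y. H' (y, 0)) (\<lambda>y. H' (y, n)) H' \<and>
    is_lift (Y \<square> path_graph n) X' \<rho> H H' \<and>
    (\<forall>y \<in> verts Y. H' (y, 0) = f' y)"
proof -
  let ?C = "Y \<square> path_graph n"
  have X: "graph X" and Y: "graph Y" and y0: "y0 \<in> verts Y" and X': "graph X'"
    using assms(1,2,5) by (auto simp: pointed_graph_def covering_graph_def)
  note cov = assms(5)
  have n: "0 < n" and H0: "\<And>y. y \<in> verts Y \<Longrightarrow> H (y, 0) = f y"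
    and Hbase: "\<And>i. i \<le> n \<Longrightarrow> H (y0, i) = x0" and Hhom: "graph_hom ?C X H"
    using assms(6) by (auto simp: graph_homotopy_def)
  have horizontal: "\<And>i u v. i \<le> n \<Longrightarrow> (u, v) \<in> edges Y \<Longrightarrow> (H (u, i), H (v, i)) \<in> edges X"
    and vertical: "\<And>i y. i < n \<Longrightarrow> y \<in> verts Y \<Longrightarrow> (H (y, i), H (y, Suc i)) \<in> edges X"
    using Hhom graph_hom_cylinder_iff[OF X Y] by blast+
  have f': "\<And>y. y \<in> verts Y \<Longrightarrow> f' y \<in> verts X' \<and> \<rho> (f' y) = H (y, 0)"
    and f'_edge: "\<And>u v. (u, v) \<in> edges Y \<Longrightarrow> (f' u, f' v) \<in> edges X'"
    using assms(7) H0 by (auto simp: is_lift_def graph_hom_def)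
  have C: "(y, i) \<in> verts ?C \<longleftrightarrow> y \<in> verts Y \<and> i \<le> n" for y i
    by (auto simp: box_prod_def path_graph_def)

  define L where "L y = lift_track X' \<rho> (\<lambda>i. H (y, i)) (f' y)" for y
  have L_0: "L y 0 = f' y" for y
    by (simp add: L_def)
  have L_over: "\<rho> (L y i) = H (y, i)" if "y \<in> verts Y" "i \<le> n" for y i
    unfolding L_def
    using lift_track_step(1)[OF X cov, of "f' y" "\<lambda>i. H (y, i)" n] that f' vertical by simp
  have L_vertical: "(L y i, L y (Suc i)) \<in> edges X'" if "y \<in> verts Y" "i < n" for y i
    unfolding L_def
    using lift_track_step(2)[OF X cov, of "f' y" "\<lambda>i. H (y, i)" n] that f' vertical by simp
  have L_horizontal: "(L u i, L v i) \<in> edges X'" if uv: "(u, v) \<in> edges Y" and "i \<le> n" for u v i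
    using \<open>i \<le> n\<close>
  proof (induction i)
    case 0
    show ?case by (simp add: L_0 f'_edge[OF uv])
  next
    case (Suc i)
    have "u \<in> verts Y" "v \<in> verts Y"
      using graph_edge_verts[OF Y uv] .
    with Suc show ?case
      using covering_completes_square[OF X assms(3,4) cov, of "L u i" "L v i"]
        L_vertical L_over horizontal[OF Suc.prems uv] by simp
  qed
  have L_base: "L y0 i = f' y0" if "i \<le> n" for i
  proof (rule walk_lift_unique[OF X cov, of n "L y0" "\<lambda>_. f' y0"])
    show "(f' y0, f' y0) \<in> edges X'"
      using f' y0 graph_loop[OF X'] by blast
    show "\<rho> (L y0 j) = \<rho> (f' y0)" if "j \<le> n" for j
      using that L_over f' y0 Hbase by simp
  qed (use L_vertical L_0 y0 that in auto)

  define K where "K = restrict (\<lambda>(y, i). L y i) (verts ?C)"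
  have K: "K (y, i) = L y i" if "y \<in> verts Y" "i \<le> n" for y i
    using that C by (simp add: K_def)
  have K_hom: "graph_hom ?C X' K"
    unfolding graph_hom_cylinder_iff[OF X' Y]
    using L_horizontal L_vertical K graph_edge_verts[OF Y] by simp
  have K_slice: "based_hom Y y0 X' (f' y0) (\<lambda>y. K (y, i))" if "i \<le> n" for i
    using that K_hom C K L_base y0 L_horizontal graph_edge_verts[OF Y]
    by (auto simp: based_hom_def graph_hom_def)
  show ?thesis
  proof (rule ex1I[of _ K], intro conjI)
    show "K \<in> extensional (verts ?C)"
      by (simp add: K_def)
    show "graph_homotopy Y y0 X' (f' y0) n (\<lambda>y. K (y, 0)) (\<lambda>y. K (y, n)) K"
      using K_slice K_hom n K L_base y0 by (simp add: graph_homotopy_def)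
    show "is_lift ?C X' \<rho> H K"
      using K_hom C K L_over by (auto simp: is_lift_def)
    show "\<forall>y \<in> verts Y. K (y, 0) = f' y"
      using K L_0 by simp
  next
    fix M
    assume M: "M \<in> extensional (verts ?C) \<and>
      graph_homotopy Y y0 X' (f' y0) n (\<lambda>y. M (y, 0)) (\<lambda>y. M (y, n)) M \<and>
      is_lift ?C X' \<rho> H M \<and> (\<forall>y \<in> verts Y. M (y, 0) = f' y)"
    then have M_over: "\<And>y i. y \<in> verts Y \<Longrightarrow> i \<le> n \<Longrightarrow> \<rho> (M (y, i)) = H (y, i)"
      and "graph_hom ?C X' M"
      using C by (auto simp: is_lift_def)
    then have M_vertical: "\<And>y i. y \<in> verts Y \<Longrightarrow> i < n \<Longrightarrow> (M (y, i), M (y, Suc i)) \<in> edges X'"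
      using graph_hom_cylinder_iff[OF X' Y] by blast
    have "M (y, i) = L y i" if "y \<in> verts Y" "i \<le> n" for y i
      using walk_lift_unique[OF X cov, of n "\<lambda>i. M (y, i)" "L y"] that
        M M_vertical M_over L_vertical L_over L_0 by simp
    then show "M = K"
      using M C K by (intro extensionalityI[of M "verts ?C"]) (auto simp: K_def)
  qed
qed

end
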